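(* For every fixed $N\ge2$, exact computation of the normalized continuous integral $R_2$ value $\overline{R}_2^{(N)}(P)$ in $N$ objectives, from an (unordered) input of $n$ points $P\subset\mathbb{R}^N_{\ge0}$ (nonnegative loss vectors being admitted), requires $\Omega(n\log n)$ time in the algebraic decision-tree model.
   Context: $\Delta_{N-1}=\{w\in\mathbb{R}^N_{\ge0}:w_1+\cdots+w_N=1\}$ with measure $dw=dw_1\cdots dw_{N-1}$ (total volume $1/(N-1)!$). For finite nonempty $P\subset\mathbb{R}^N_{\ge0}$, $\overline{R}_2^{(N)}(P)=(N-1)!\int_{\Delta_{N-1}}\min_{p\in P}\max_{1\le i\le N}w_ip_i\,dw$. The algebraic decision-tree model is the standard model (Ben-Or) in which real inputs are processed by arithmetic operations and sign tests of the computed values, and the cost is the depth of the tree; the lower bound is in the worst case. *)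

theory Defs
  imports "HOL-Analysis.Analysis" "HOL-Library.Monad_Syntax"
begin

text \<open>Vectors of \<open>\<real>\<^sup>N\<close> are extensional functions on the index set \<open>{..<N}\<close>, so that
  two points are equal iff their \<open>N\<close> coordinates agree.\<close>

definition nonneg_vectors :: "nat \<Rightarrow> (nat \<Rightarrow> real) set" where
  "nonneg_vectors N = {..<N} \<rightarrow>\<^sub>E {0..}"

definition std_simplex :: "nat \<Rightarrow> (nat \<Rightarrow> real) set" where
  "std_simplex N = {w \<in> nonneg_vectors N. (\<Sum>i<N. w i) = 1}"

text \<open>The measure on the simplex is Lebesgue measure in the first \<open>N - 1\<close> coordinates; the last
  coordinate is recovered from the condition that all of them sum to \<open>1\<close>.\<close>

definition simplex_chart :: "nat \<Rightarrow> (nat \<Rightarrow> real) \<Rightarrow> nat \<Rightarrow> real" where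
  "simplex_chart N v = v(N - 1 := 1 - (\<Sum>i<N - 1. v i))"

definition R2_integrand :: "nat \<Rightarrow> (nat \<Rightarrow> real) set \<Rightarrow> (nat \<Rightarrow> real) \<Rightarrow> real" where
  "R2_integrand N P w = (MIN p\<in>P. MAX i\<in>{..<N}. w i * p i)"

definition R2_normalized :: "nat \<Rightarrow> (nat \<Rightarrow> real) set \<Rightarrow> real" where
  "R2_normalized N P =
     fact (N - 1) *
     (LINT v : simplex_chart N -` std_simplex N | (\<Pi>\<^sub>M i\<in>{..<N - 1}. lborel).
        R2_integrand N P (simplex_chart N v))"

text \<open>A computation tree works on a list of real registers that initially holds the input;
  every arithmetic step appends its result. Arbitrary real constants are available at no cost. A
  sign test branches three ways (negative, zero, positive), which subsumes tests such as
  \<open>f > 0\<close>, \<open>f \<ge> 0\<close> and \<open>f = 0\<close>.\<close>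

datatype operand = Const real | Reg nat

datatype arith_op = Add | Sub | Mul | Div

datatype comp_tree =
    Output operand
  | Compute arith_op operand operand comp_tree
  | Branch operand comp_tree comp_tree comp_tree

fun fetch :: "real list \<Rightarrow> operand \<Rightarrow> real option" where
  "fetch m (Const c) = Some c"
| "fetch m (Reg k) = (if k < length m then Some (m ! k) else None)"

fun apply_op :: "arith_op \<Rightarrow> real \<Rightarrow> real \<Rightarrow> real option" where
  "apply_op Add x y = Some (x + y)"
| "apply_op Sub x y = Some (x - y)"
| "apply_op Mul x y = Some (x * y)"
| "apply_op Div x y = (if y = 0 then None else Some (x / y))"

text \<open>The result \<^term>\<open>None\<close> stands for a failed run: a division by zero or an access to an
  unassigned register.\<close>

fun run :: "comp_tree \<Rightarrow> real list \<Rightarrow> real option" where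
  "run (Output a) m = fetch m a"
| "run (Compute f a b t) m =
     do { x \<leftarrow> fetch m a; y \<leftarrow> fetch m b; z \<leftarrow> apply_op f x y; run t (m @ [z]) }"
| "run (Branch a t_neg t_zero t_pos) m =
     do { x \<leftarrow> fetch m a;
          if x < 0 then run t_neg m else if x = 0 then run t_zero m else run t_pos m }"

fun depth :: "comp_tree \<Rightarrow> nat" where
  "depth (Output a) = 0"
| "depth (Compute f a b t) = Suc (depth t)"
| "depth (Branch a t_neg t_zero t_pos) = Suc (max (depth t_neg) (max (depth t_zero) (depth t_pos)))"

definition input_registers :: "nat \<Rightarrow> (nat \<Rightarrow> real) list \<Rightarrow> real list" where
  "input_registers N ps = concat (map (\<lambda>p. map p [0..<N]) ps)"

text \<open>The tree receives the \<open>n\<close>-element set in an arbitrary order and has to be correct for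
  every enumeration.\<close>

definition computes_R2 :: "nat \<Rightarrow> nat \<Rightarrow> comp_tree \<Rightarrow> bool" where
  "computes_R2 N n T \<longleftrightarrow>
     (\<forall>ps. length ps = n \<and> distinct ps \<and> set ps \<subseteq> nonneg_vectors N \<longrightarrow>
        run T (input_registers N ps) = Some (R2_normalized N (set ps)))"

end

theory Submission
  imports Defs "HOL-Computational_Algebra.Polynomial" "HOL-Combinatorics.Multiset_Permutations"
begin

text \<open>Restrict the input to points \<open>(x\<^sub>k, 0, \<dots>, 0, 1 - x\<^sub>k)\<close> with \<open>0 < x\<^sub>k < 1\<close>. When \<open>a\<close> directly
  precedes \<open>b\<close> among the sorted \<open>x\<^sub>k\<close>, the integral contains the term
  \<open>\<gamma> b (1 - a) / (b + 1 - a)\<close>, and the rest of it is a symmetric polynomial plus two linear boundary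
  terms. On each of the \<open>n!\<close> order cells the value is therefore a rational function of \<open>x\<close>, and its
  poles reveal the order. A leaf of the tree outputs a single rational function, and for every cell
  some leaf is reached on a nonempty open part of it. Hence distinct orders need distinct leaves,
  which gives \<open>n! \<le> 3 ^ depth\<close>; no bound on the number of connected components is
  needed because the tree has to output the exact value.\<close>

section \<open>Branch-free parts of computation trees\<close>

text \<open>Each element is a root-to-leaf path with its tests removed. Tests write no register, so
  the numbering of the registers survives and \<open>run\<close> applies to the path, which no
  longer checks whether its input belongs to it.\<close>

fun straight :: "comp_tree \<Rightarrow> comp_tree set" where
  "straight (Output a) = {Output a}"
| "straight (Compute f a b t) = Compute f a b ` straight t"
| "straight (Branch a t_neg t_zero t_pos) = straight t_neg \<union> straight t_zero \<union> straight t_pos"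

lemma finite_straight: "finite (straight T)"
  by (induction T) auto

text \<open>Only a test multiplies the number of paths, by at most three.\<close>

lemma card_straight_le: "card (straight T) \<le> 3 ^ depth T"
proof (induction T)
  case (Compute f a b t)
  have "card (straight (Compute f a b t)) \<le> card (straight t)"
    by (simp add: card_image_le finite_straight)
  also have "\<dots> \<le> 3 ^ depth (Compute f a b t)"
    using Compute by simp
  finally show ?case .
next
  case (Branch a t1 t2 t3)
  define d where "d = max (depth t1) (max (depth t2) (depth t3))"
  have "(3::nat) ^ depth t1 \<le> 3 ^ d" "(3::nat) ^ depth t2 \<le> 3 ^ d" "(3::nat) ^ depth t3 \<le> 3 ^ d"
    by (auto simp: d_def intro!: power_increasing)
  moreover have "card (straight (Branch a t1 t2 t3))
      \<le> card (straight t1) + card (straight t2) + card (straight t3)"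
    using card_Un_le[of "straight t1 \<union> straight t2" "straight t3"]
      card_Un_le[of "straight t1" "straight t2"] by simp
  ultimately have "card (straight (Branch a t1 t2 t3)) \<le> 3 * 3 ^ d"
    using Branch by linarith
  then show ?case by (simp add: d_def)
qed auto

lemma continuous_on_fetch:
  assumes "\<And>x. x \<in> U \<Longrightarrow> length (m x) = len"
    and "\<And>k. k < len \<Longrightarrow> continuous_on U (\<lambda>x. m x ! k)"
    and "\<And>x. x \<in> U \<Longrightarrow> fetch (m x) a \<noteq> None"
  shows "\<exists>u. continuous_on U u \<and> (\<forall>x\<in>U. fetch (m x) a = Some (u x :: real))"
proof (cases a)
  case (Const c)
  then show ?thesis by (auto intro!: exI[of _ "\<lambda>_. c"])
next
  case (Reg k)
  show ?thesis
  proof (cases "k < len")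
    case True
    then show ?thesis using Reg assms(1,2) by (auto intro!: exI[of _ "\<lambda>x. m x ! k"])
  next
    case False
    \<comment> \<open>Reading an unassigned register would fail at every point of \<open>U\<close>,
      so there is no such point.\<close>
    then have "U = {}" using Reg assms(1,3) by fastforce
    then show ?thesis by simp
  qed
qed

text \<open>At a test the inspected value is a continuous function on \<open>U\<close>. Its negative
  and positive sets are open, and if both are empty it vanishes on all of \<open>U\<close>; in each
  case a single branch serves a nonempty open set. The registers are functions \<open>m\<close> of
  an abstract point, so that computed values can be appended during the induction.\<close>

lemma run_eq_straight_on_open:
  fixes m :: "'a::topological_space \<Rightarrow> real list"
  assumes "open U" "U \<noteq> {}"
    and "\<And>x. x \<in> U \<Longrightarrow> length (m x) = len"
    and "\<And>k. k < len \<Longrightarrow> continuous_on U (\<lambda>x. m x ! k)"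
    and "\<And>x. x \<in> U \<Longrightarrow> run T (m x) \<noteq> None"
  shows "\<exists>L\<in>straight T. \<exists>V\<subseteq>U. open V \<and> V \<noteq> {} \<and> (\<forall>x\<in>V. run T (m x) = run L (m x))"
  using assms
proof (induction T arbitrary: U m len)
  case (Output a)
  then show ?case by auto
next
  case (Compute f a b T)
  have "fetch (m x) a \<noteq> None" "fetch (m x) b \<noteq> None" if "x \<in> U" for x
    using Compute.prems(5)[OF that] by (auto split: bind_splits)
  then obtain u v where u: "continuous_on U u" "\<And>x. x \<in> U \<Longrightarrow> fetch (m x) a = Some (u x)"
    and v: "continuous_on U v" "\<And>x. x \<in> U \<Longrightarrow> fetch (m x) b = Some (v x)"
    using continuous_on_fetch[of U m len] Compute.prems(3,4) by metis
  have "\<exists>w. continuous_on U w \<and> (\<forall>x\<in>U. apply_op f (u x) (v x) = Some (w x))"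
  proof (cases f)
    case Add
    then show ?thesis using u v by (auto intro!: exI[of _ "\<lambda>x. u x + v x"] continuous_intros)
  next
    case Sub
    then show ?thesis using u v by (auto intro!: exI[of _ "\<lambda>x. u x - v x"] continuous_intros)
  next
    case Mul
    then show ?thesis using u v by (auto intro!: exI[of _ "\<lambda>x. u x * v x"] continuous_intros)
  next
    case Div
    \<comment> \<open>A zero divisor would make the run fail, so the quotient is continuous on all
      of \<open>U\<close>.\<close>
    have "v x \<noteq> 0" if "x \<in> U" for x
      using Compute.prems(5)[OF that] u(2)[OF that] v(2)[OF that] Div by auto
    then show ?thesis
      using u v Div by (auto intro!: exI[of _ "\<lambda>x. u x / v x"] continuous_intros)
  qed
  then obtain w where w: "continuous_on U w"
    "\<And>x. x \<in> U \<Longrightarrow> apply_op f (u x) (v x) = Some (w x)"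
    by blast
  have run: "run (Compute f a b L) (m x) = run L (m x @ [w x])" if "x \<in> U" for x L
    using u(2)[OF that] v(2)[OF that] w(2)[OF that] by simp
  have "\<exists>L\<in>straight T. \<exists>V\<subseteq>U. open V \<and> V \<noteq> {} \<and>
      (\<forall>x\<in>V. run T (m x @ [w x]) = run L (m x @ [w x]))"
  proof (rule Compute.IH[where len = "Suc len"])
    show "continuous_on U (\<lambda>x. (m x @ [w x]) ! k)" if "k < Suc len" for k
    proof (cases "k < len")
      case True
      have "continuous_on U (\<lambda>x. (m x @ [w x]) ! k) \<longleftrightarrow> continuous_on U (\<lambda>x. m x ! k)"
        using True Compute.prems(3) by (intro continuous_on_cong) (auto simp: nth_append)
      then show ?thesis using True Compute.prems(4) by blast
    next
      case False
      have "continuous_on U (\<lambda>x. (m x @ [w x]) ! k) \<longleftrightarrow> continuous_on U w"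
        using False that Compute.prems(3) by (intro continuous_on_cong) (auto simp: nth_append)
      then show ?thesis using w(1) by blast
    qed
    show "run T (m x @ [w x]) \<noteq> None" if "x \<in> U" for x
      using Compute.prems(5)[OF that] run[OF that] by simp
  qed (use Compute.prems(1-3) in auto)
  then obtain L V where LV: "L \<in> straight T" "V \<subseteq> U" "open V" "V \<noteq> {}"
    "\<forall>x\<in>V. run T (m x @ [w x]) = run L (m x @ [w x])"
    by blast
  have "\<forall>x\<in>V. run (Compute f a b T) (m x) = run (Compute f a b L) (m x)"
    using LV(2,5) run by (simp add: subset_iff del: run.simps)
  moreover have "Compute f a b L \<in> straight (Compute f a b T)"
    using LV(1) by simp
  ultimately show ?case
    using LV(2-4) by blast
next
  case (Branch a T1 T2 T3)
  have "fetch (m x) a \<noteq> None" if "x \<in> U" for x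
    using Branch.prems(5)[OF that] by (auto split: bind_splits)
  then obtain u where u: "continuous_on U u" "\<And>x. x \<in> U \<Longrightarrow> fetch (m x) a = Some (u x)"
    using continuous_on_fetch[of U m len] Branch.prems(3,4) by metis
  have cont: "continuous_on V (\<lambda>x. m x ! k)" if "V \<subseteq> U" "k < len" for V k
    by (rule continuous_on_subset[OF Branch.prems(4)[OF that(2)] that(1)])
  have neg: "open (U \<inter> u -` {..<0})" and pos: "open (U \<inter> u -` {0<..})"
    using u(1) Branch.prems(1) by (auto intro!: continuous_open_preimage)
  have sub: "\<exists>L\<in>straight (Branch a T1 T2 T3). \<exists>V\<subseteq>U. open V \<and> V \<noteq> {} \<and>
      (\<forall>x\<in>V. run (Branch a T1 T2 T3) (m x) = run L (m x))"
    if W: "W \<subseteq> U" "S \<subseteq> straight (Branch a T1 T2 T3)"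
      "\<And>x. x \<in> W \<Longrightarrow> run (Branch a T1 T2 T3) (m x) = run T' (m x)"
      "\<exists>L\<in>S. \<exists>V\<subseteq>W. open V \<and> V \<noteq> {} \<and> (\<forall>x\<in>V. run T' (m x) = run L (m x))"
    for W S T'
  proof -
    obtain L V where "L \<in> S" "V \<subseteq> W" "open V" "V \<noteq> {}" "\<forall>x\<in>V. run T' (m x) = run L (m x)"
      using W(4) by blast
    moreover from this have "\<forall>x\<in>V. run (Branch a T1 T2 T3) (m x) = run L (m x)"
      using W(3) by (metis subsetD)
    ultimately show ?thesis
      using W(1,2) by blast
  qed
  have len: "length (m x) = len" if "x \<in> U" for x
    using Branch.prems(3) that by blast
  \<comment> \<open>The zero set need not be open, so the middle branch is followed only when it
    contains all of \<open>U\<close>.\<close>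
  have "U \<inter> u -` {..<0} \<noteq> {} \<or> U \<inter> u -` {0<..} \<noteq> {} \<or> (\<forall>x\<in>U. u x = 0)"
    by (metis Int_iff emptyE greaterThan_iff lessThan_iff linorder_less_linear vimageI)
  then consider "U \<inter> u -` {..<0} \<noteq> {}" | "U \<inter> u -` {0<..} \<noteq> {}" | "\<forall>x\<in>U. u x = 0"
    by blast
  then show ?case
  proof cases
    case 1
    have run: "run (Branch a T1 T2 T3) (m x) = run T1 (m x)" if "x \<in> U \<inter> u -` {..<0}" for x
      using that u(2)[of x] by simp
    have "\<exists>L\<in>straight T1. \<exists>V\<subseteq>U \<inter> u -` {..<0}. open V \<and> V \<noteq> {} \<and>
        (\<forall>x\<in>V. run T1 (m x) = run L (m x))"
    proof (rule Branch.IH(1)[OF neg 1])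
      show "length (m x) = len" if "x \<in> U \<inter> u -` {..<0}" for x
        using len that by blast
      show "continuous_on (U \<inter> u -` {..<0}) (\<lambda>x. m x ! r)" if "r < len" for r
        using that by (intro cont) auto
      show "run T1 (m x) \<noteq> None" if "x \<in> U \<inter> u -` {..<0}" for x
        using run[OF that] Branch.prems(5)[of x] that by (simp del: run.simps)
    qed
    then show ?thesis
      by (rule sub[OF Int_lower1 _ run, rotated 2]) auto
  next
    case 2
    have run: "run (Branch a T1 T2 T3) (m x) = run T3 (m x)" if "x \<in> U \<inter> u -` {0<..}" for x
      using that u(2)[of x] by simp
    have "\<exists>L\<in>straight T3. \<exists>V\<subseteq>U \<inter> u -` {0<..}. open V \<and> V \<noteq> {} \<and>
        (\<forall>x\<in>V. run T3 (m x) = run L (m x))"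
    proof (rule Branch.IH(3)[OF pos 2])
      show "length (m x) = len" if "x \<in> U \<inter> u -` {0<..}" for x
        using len that by blast
      show "continuous_on (U \<inter> u -` {0<..}) (\<lambda>x. m x ! r)" if "r < len" for r
        using that by (intro cont) auto
      show "run T3 (m x) \<noteq> None" if "x \<in> U \<inter> u -` {0<..}" for x
        using run[OF that] Branch.prems(5)[of x] that by (simp del: run.simps)
    qed
    then show ?thesis
      by (rule sub[OF Int_lower1 _ run, rotated 2]) auto
  next
    case 3
    have run: "run (Branch a T1 T2 T3) (m x) = run T2 (m x)" if "x \<in> U" for x
      using that u(2)[of x] 3 by simp
    have "\<exists>L\<in>straight T2. \<exists>V\<subseteq>U. open V \<and> V \<noteq> {} \<and>
        (\<forall>x\<in>V. run T2 (m x) = run L (m x))"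
    proof (rule Branch.IH(2)[OF Branch.prems(1,2)])
      show "length (m x) = len" if "x \<in> U" for x
        using len that by blast
      show "continuous_on (U) (\<lambda>x. m x ! r)" if "r < len" for r
        using that by (intro cont) auto
      show "run T2 (m x) \<noteq> None" if "x \<in> U" for x
        using run[OF that] Branch.prems(5)[of x] that by (simp del: run.simps)
    qed
    then show ?thesis
      by (rule sub[OF subset_refl _ run, rotated 2]) auto
  qed
qed

section \<open>Rational functions along a curve\<close>

text \<open>Functions agreeing with a quotient of polynomials off a finite set; the values of a
  totalised quotient at its poles are irrelevant.\<close>

definition rational_fun :: "(real \<Rightarrow> real) \<Rightarrow> bool" where
  "rational_fun f \<longleftrightarrow> (\<exists>p q. q \<noteq> 0 \<and> (\<forall>\<^sub>F t in cofinite. f t = poly p t / poly q t))"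

lemma eventually_poly_neq_0: "q \<noteq> 0 \<Longrightarrow> \<forall>\<^sub>F t in cofinite. poly q t \<noteq> (0::real)"
  by (simp add: eventually_cofinite poly_roots_finite)

lemma rational_fun_poly: "rational_fun (poly p)"
  unfolding rational_fun_def by (rule exI[of _ p], rule exI[of _ 1]) simp

lemma rational_fun_const: "rational_fun (\<lambda>_. c)"
  unfolding rational_fun_def by (rule exI[of _ "[:c:]"], rule exI[of _ 1]) simp

lemma rational_fun_add:
  assumes "rational_fun f" "rational_fun g"
  shows "rational_fun (\<lambda>t. f t + g t)"
proof -
  obtain p q r s where qs: "q \<noteq> 0" "s \<noteq> 0" and
    ev: "\<forall>\<^sub>F t in cofinite. f t = poly p t / poly q t" "\<forall>\<^sub>F t in cofinite. g t = poly r t / poly s t"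
    using assms unfolding rational_fun_def by blast
  have "\<forall>\<^sub>F t in cofinite. f t + g t = poly (p * s + r * q) t / poly (q * s) t"
    using ev eventually_poly_neq_0[OF qs(1)] eventually_poly_neq_0[OF qs(2)]
    by eventually_elim (simp add: field_simps)
  then show ?thesis
    unfolding rational_fun_def using qs by (metis mult_eq_0_iff)
qed

lemma rational_fun_mult:
  assumes "rational_fun f" "rational_fun g"
  shows "rational_fun (\<lambda>t. f t * g t)"
proof -
  obtain p q r s where qs: "q \<noteq> 0" "s \<noteq> 0" and
    ev: "\<forall>\<^sub>F t in cofinite. f t = poly p t / poly q t" "\<forall>\<^sub>F t in cofinite. g t = poly r t / poly s t"
    using assms unfolding rational_fun_def by blast
  have "\<forall>\<^sub>F t in cofinite. f t * g t = poly (p * r) t / poly (q * s) t"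
    using ev by eventually_elim simp
  then show ?thesis
    unfolding rational_fun_def using qs by (metis mult_eq_0_iff)
qed

text \<open>Numerator and denominator change places, unless the numerator is the zero
  polynomial.\<close>

lemma rational_fun_inverse:
  assumes "rational_fun f"
  shows "rational_fun (\<lambda>t. inverse (f t))"
proof -
  obtain p q where q: "q \<noteq> 0" and ev: "\<forall>\<^sub>F t in cofinite. f t = poly p t / poly q t"
    using assms unfolding rational_fun_def by blast
  show ?thesis
  proof (cases "p = 0")
    \<comment> \<open>Here \<open>f\<close> vanishes almost everywhere, and so does its inverse by
      the convention \<open>inverse 0 = 0\<close>.\<close>
    case True
    have "\<forall>\<^sub>F t in cofinite. inverse (f t) = poly 0 t / poly q t"
      using ev by eventually_elim (simp add: True)
    then show ?thesis
      unfolding rational_fun_def using q by blast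
  next
    case False
    have "\<forall>\<^sub>F t in cofinite. inverse (f t) = poly q t / poly p t"
      using ev by eventually_elim simp
    then show ?thesis
      unfolding rational_fun_def using False by blast
  qed
qed

lemma rational_fun_diff:
  assumes "rational_fun f" "rational_fun g"
  shows "rational_fun (\<lambda>t. f t - g t)"
  using rational_fun_add[OF assms(1) rational_fun_mult[OF rational_fun_const[of "-1"] assms(2)]]
  by simp

lemma rational_fun_divide:
  assumes "rational_fun f" "rational_fun g"
  shows "rational_fun (\<lambda>t. f t / g t)"
  using rational_fun_mult[OF assms(1) rational_fun_inverse[OF assms(2)]]
  by (simp add: field_class.field_divide_inverse)

lemma rational_fun_sum:
  assumes "\<And>x. x \<in> A \<Longrightarrow> rational_fun (f x)"
  shows "rational_fun (\<lambda>t. \<Sum>x\<in>A. f x t)"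
  using assms
  by (induction A rule: infinite_finite_induct) (auto intro: rational_fun_const rational_fun_add)

text \<open>A nonzero polynomial has finitely many roots. This is the identity theorem in the form
  used below: it decides whether a division fails almost always or almost never, and it compares two
  rational functions through their difference.\<close>

lemma rational_fun_zero_or_nonzero:
  assumes "rational_fun f"
  shows "(\<forall>\<^sub>F t in cofinite. f t = 0) \<or> (\<forall>\<^sub>F t in cofinite. f t \<noteq> 0)"
proof -
  obtain p q where q: "q \<noteq> 0" and ev: "\<forall>\<^sub>F t in cofinite. f t = poly p t / poly q t"
    using assms unfolding rational_fun_def by blast
  show ?thesis
  proof (cases "p = 0")
    case True
    with ev show ?thesis by simp
  next
    case False
    have "\<forall>\<^sub>F t in cofinite. f t \<noteq> 0"
      using ev eventually_poly_neq_0[OF q] eventually_poly_neq_0[OF False]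
      by eventually_elim simp
    then show ?thesis ..
  qed
qed

section \<open>Straight-line programs along a curve\<close>

lemma fetch_rational:
  assumes "\<And>t. length (m t) = len" "\<And>k. k < len \<Longrightarrow> rational_fun (\<lambda>t. m t ! k)"
  shows "(\<forall>t. fetch (m t) a = None) \<or> (\<exists>u. rational_fun u \<and> (\<forall>t. fetch (m t) a = Some (u t)))"
proof (cases a)
  case (Const c)
  then show ?thesis using rational_fun_const[of c] by auto
next
  case (Reg k)
  then show ?thesis using assms by auto
qed

text \<open>Every register stays rational in the curve parameter, so each divisor is either zero
  almost everywhere, and the program fails there, or nonzero almost everywhere, and the quotient is
  again rational. The induction is on \<open>T\<close> because \<open>straight T\<close> describes
  the shape of \<open>L\<close>.\<close>

lemma straight_run_rational:
  assumes "L \<in> straight T"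
    and "\<And>t. length (m t) = len" "\<And>k. k < len \<Longrightarrow> rational_fun (\<lambda>t. m t ! k)"
  shows "(\<forall>\<^sub>F t in cofinite. run L (m t) = None) \<or>
    (\<exists>g. rational_fun g \<and> (\<forall>\<^sub>F t in cofinite. run L (m t) = Some (g t)))"
  using assms
proof (induction T arbitrary: L m len)
  case (Output a)
  then show ?case using fetch_rational[of m len a] by (auto intro: always_eventually)
next
  case (Compute f a b T)
  then obtain L' where L: "L = Compute f a b L'" "L' \<in> straight T" by auto
  show ?case
  proof (cases "(\<forall>t. fetch (m t) a = None) \<or> (\<forall>t. fetch (m t) b = None)")
    case True
    then have "run L (m t) = None" for t
      by (auto simp: L bind_eq_None_conv)
    then show ?thesis by simp
  next
    case False
    then obtain u v where u: "rational_fun u" "\<And>t. fetch (m t) a = Some (u t)"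
      and v: "rational_fun v" "\<And>t. fetch (m t) b = Some (v t)"
      using fetch_rational[of m len, OF Compute.prems(2,3)] by metis
    have step: "(\<forall>\<^sub>F t in cofinite. run L (m t) = None) \<or>
        (\<exists>g. rational_fun g \<and> (\<forall>\<^sub>F t in cofinite. run L (m t) = Some (g t)))"
      if w: "rational_fun w" and op: "\<forall>\<^sub>F t in cofinite. apply_op f (u t) (v t) = Some (w t)" for w
    proof -
      have reg: "rational_fun (\<lambda>t. (m t @ [w t]) ! k)" if "k < Suc len" for k
        using that w Compute.prems(2,3) by (cases "k < len") (auto simp: nth_append less_Suc_eq)
      have run: "\<forall>\<^sub>F t in cofinite. run L (m t) = run L' (m t @ [w t])"
        using op by eventually_elim (simp add: L u v)
      have "(\<forall>\<^sub>F t in cofinite. run L' (m t @ [w t]) = None) \<or>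
          (\<exists>g. rational_fun g \<and> (\<forall>\<^sub>F t in cofinite. run L' (m t @ [w t]) = Some (g t)))"
        using Compute.IH[OF L(2), of "\<lambda>t. m t @ [w t]" "Suc len"] Compute.prems(2) reg by simp
      then show ?thesis
      proof (elim disjE exE conjE)
        assume "\<forall>\<^sub>F t in cofinite. run L' (m t @ [w t]) = None"
        with run have "\<forall>\<^sub>F t in cofinite. run L (m t) = None" by eventually_elim simp
        then show ?thesis ..
      next
        fix g assume "rational_fun g" "\<forall>\<^sub>F t in cofinite. run L' (m t @ [w t]) = Some (g t)"
        from this(2) run have "\<forall>\<^sub>F t in cofinite. run L (m t) = Some (g t)" by eventually_elim simp
        with \<open>rational_fun g\<close> show ?thesis by blast
      qed
    qed
    show ?thesis
    proof (cases f)
      case Add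
      then show ?thesis using step[OF rational_fun_add[OF u(1) v(1)]] by simp
    next
      case Sub
      then show ?thesis using step[OF rational_fun_diff[OF u(1) v(1)]] by simp
    next
      case Mul
      then show ?thesis using step[OF rational_fun_mult[OF u(1) v(1)]] by simp
    next
      case Div
      \<comment> \<open>Division is the only operation that can fail once the operands are
        available; the dichotomy for the divisor settles both cases.\<close>
      from rational_fun_zero_or_nonzero[OF v(1)] show ?thesis
      proof
        assume "\<forall>\<^sub>F t in cofinite. v t = 0"
        then have "\<forall>\<^sub>F t in cofinite. run L (m t) = None"
          by eventually_elim (simp add: L u v Div)
        then show ?thesis ..
      next
        assume "\<forall>\<^sub>F t in cofinite. v t \<noteq> 0"
        then have "\<forall>\<^sub>F t in cofinite. apply_op f (u t) (v t) = Some (u t / v t)"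
          by eventually_elim (simp add: Div)
        then show ?thesis using step[OF rational_fun_divide[OF u(1) v(1)]] by simp
      qed
    qed
  qed
next
  case (Branch a T1 T2 T3)
  from Branch.prems(1) consider "L \<in> straight T1" | "L \<in> straight T2" | "L \<in> straight T3"
    by auto
  then show ?case
  proof cases
    case 1
    show ?thesis by (rule Branch.IH(1)[OF 1 Branch.prems(2,3)])
  next
    case 2
    show ?thesis by (rule Branch.IH(2)[OF 2 Branch.prems(2,3)])
  next
    case 3
    show ?thesis by (rule Branch.IH(3)[OF 3 Branch.prems(2,3)])
  qed
qed

text \<open>Success on an infinite set excludes failure almost everywhere, and the rational function
  computed by \<open>L\<close> then agrees with \<open>F\<close> infinitely often, hence almost
  everywhere.\<close>

lemma straight_run_rational_extend:
  assumes "L \<in> straight T"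
    and "\<And>t. length (m t) = len" "\<And>k. k < len \<Longrightarrow> rational_fun (\<lambda>t. m t ! k)"
    and "rational_fun F" "infinite S" "\<And>t. t \<in> S \<Longrightarrow> run L (m t) = Some (F t)"
  shows "\<forall>\<^sub>F t in cofinite. run L (m t) = Some (F t)"
proof -
  \<comment> \<open>An infinite set meets every cofinite set.\<close>
  have S: "\<not> (\<forall>\<^sub>F t in cofinite. t \<notin> S)"
    using \<open>infinite S\<close> by (simp add: eventually_cofinite)
  have "(\<forall>\<^sub>F t in cofinite. run L (m t) = None) \<or>
      (\<exists>g. rational_fun g \<and> (\<forall>\<^sub>F t in cofinite. run L (m t) = Some (g t)))"
    by (rule straight_run_rational[OF assms(1)]) (use assms(2,3) in simp_all)
  then show ?thesis
  proof (elim disjE exE conjE)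
    assume "\<forall>\<^sub>F t in cofinite. run L (m t) = None"
    then have "\<forall>\<^sub>F t in cofinite. t \<notin> S"
      by eventually_elim (use assms(6) in force)
    with S show ?thesis by contradiction
  next
    fix g assume g: "rational_fun g" "\<forall>\<^sub>F t in cofinite. run L (m t) = Some (g t)"
    from rational_fun_zero_or_nonzero[OF rational_fun_diff[OF g(1) assms(4)]] show ?thesis
    proof
      assume "\<forall>\<^sub>F t in cofinite. g t - F t = 0"
      with g(2) show ?thesis by eventually_elim simp
    next
      assume "\<forall>\<^sub>F t in cofinite. g t - F t \<noteq> 0"
      with g(2) have "\<forall>\<^sub>F t in cofinite. t \<notin> S"
        by eventually_elim (use assms(6) in force)
      with S show ?thesis by contradiction
    qed
  qed
qed

section \<open>Volumes in the simplex chart\<close>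

abbreviation lborel_box :: "nat \<Rightarrow> (nat \<Rightarrow> real) measure" where
  "lborel_box d \<equiv> \<Pi>\<^sub>M i\<in>{..<d}. lborel"

text \<open>For \<open>t = 1\<close> and \<open>d = N - 1\<close> this is the domain of the chart of
  the standard simplex. The size \<open>t\<close> is a parameter because cutting the unit simplex
  parallel to its faces leaves translates of smaller ones.\<close>

definition corner_simplex :: "nat \<Rightarrow> real \<Rightarrow> (nat \<Rightarrow> real) set" where
  "corner_simplex d t = {v \<in> space (lborel_box d). (\<forall>i\<in>{..<d}. 0 \<le> v i) \<and> (\<Sum>i<d. v i) \<le> t}"

lemma measurable_coordinate: "i < d \<Longrightarrow> (\<lambda>v. v i) \<in> borel_measurable (lborel_box d)"
  using measurable_component_singleton[of i "{..<d}" "\<lambda>_. lborel :: real measure"] by simp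

lemma measurable_sum_coordinates [measurable]:
  "(\<lambda>v. \<Sum>i<d. v i) \<in> borel_measurable (lborel_box d)"
  by (intro borel_measurable_sum measurable_coordinate) auto

lemma sets_corner_simplex [measurable]: "corner_simplex d t \<in> sets (lborel_box d)"
  unfolding corner_simplex_def by measurable

lemma emeasure_corner_simplex:
  "t \<ge> 0 \<Longrightarrow> emeasure (lborel_box d) (corner_simplex d t) = ennreal (t ^ d / fact d)"
  using emeasure_std_simplex_aux[of "{..<d}" t]
  by (simp add: corner_simplex_def Int_def conj_commute)

text \<open>A product measure is determined by its values on boxes, where translation invariance of
  \<open>lborel\<close> applies in each factor. The restriction keeps the shifted vectors
  extensional.\<close>

lemma distr_lborel_box_translate:
  "distr (lborel_box d) (lborel_box d) (\<lambda>v. \<lambda>i\<in>{..<d}. v i + c i) = lborel_box d"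
proof -
  interpret product_sigma_finite "\<lambda>_::nat. lborel :: real measure"
    by standard
  show ?thesis
  proof (rule PiM_eqI)
    fix A :: "nat \<Rightarrow> real set"
    assume A: "\<And>i. i \<in> {..<d} \<Longrightarrow> A i \<in> sets lborel"
    have [measurable]: "(\<lambda>v. \<lambda>i\<in>{..<d}. v i + c i) \<in> lborel_box d \<rightarrow>\<^sub>M lborel_box d"
      by measurable
    have shift: "(\<lambda>x. x + c i) -` A i \<in> sets lborel" if "i \<in> {..<d}" for i
    proof -
      have "(\<lambda>x. x + c i) -` A i \<inter> space borel \<in> sets borel"
        using A[OF that] by (intro measurable_sets[of _ borel borel]) auto
      then show ?thesis by simp
    qed
    have "emeasure (distr (lborel_box d) (lborel_box d) (\<lambda>v. \<lambda>i\<in>{..<d}. v i + c i)) (Pi\<^sub>E {..<d} A)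
        = emeasure (lborel_box d) ((\<lambda>v. \<lambda>i\<in>{..<d}. v i + c i) -` Pi\<^sub>E {..<d} A \<inter> space (lborel_box d))"
      using A by (intro emeasure_distr sets_PiM_I_finite) auto
    also have "(\<lambda>v. \<lambda>i\<in>{..<d}. v i + c i) -` Pi\<^sub>E {..<d} A \<inter> space (lborel_box d)
        = Pi\<^sub>E {..<d} (\<lambda>i. (\<lambda>x. x + c i) -` A i)"
      by (auto simp: space_PiM PiE_iff)
    also have "emeasure (lborel_box d) \<dots> = (\<Prod>i<d. emeasure lborel ((\<lambda>x. x + c i) -` A i))"
      using shift by (intro emeasure_PiM) auto
    also have "\<dots> = (\<Prod>i<d. emeasure lborel (A i))"
    proof (rule prod.cong)
      fix i assume i: "i \<in> {..<d}"
      have "emeasure lborel (A i) = emeasure (distr lborel borel ((+) (c i))) (A i)"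
        by (simp add: lborel_distr_plus)
      also have "\<dots> = emeasure lborel ((\<lambda>x. x + c i) -` A i)"
        using A[OF i] by (subst emeasure_distr) (auto simp: add.commute[of "c i"] vimage_def)
      finally show "emeasure lborel ((\<lambda>x. x + c i) -` A i) = emeasure lborel (A i)" ..
    qed simp
    finally show "emeasure (distr (lborel_box d) (lborel_box d) (\<lambda>v. \<lambda>i\<in>{..<d}. v i + c i)) (Pi\<^sub>E {..<d} A)
        = (\<Prod>i<d. emeasure lborel (A i))" .
  qed auto
qed

lemma sets_corner_simplex_cut:
  assumes "0 < d"
  shows "{v \<in> corner_simplex d 1. \<alpha> \<le> v 0 \<and> \<beta> \<le> 1 - (\<Sum>i<d. v i)} \<in> sets (lborel_box d)"
proof -
  note [measurable] = measurable_coordinate[OF assms]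
  have "{v \<in> corner_simplex d 1. \<alpha> \<le> v 0 \<and> \<beta> \<le> 1 - (\<Sum>i<d. v i)} = corner_simplex d 1 \<inter>
      {v \<in> space (lborel_box d). \<alpha> \<le> v 0 \<and> \<beta> \<le> 1 - (\<Sum>i<d. v i)}"
    by (auto simp: corner_simplex_def)
  also have "\<dots> \<in> sets (lborel_box d)"
    by measurable
  finally show ?thesis .
qed

text \<open>Lowering coordinate 0 by \<alpha> turns the first cut into nonnegativity, while the
  second cut bounds the remaining sum by 1 - \<alpha> - \<beta>. The cut region is thus a translate
  of a corner simplex of that size, or empty if the size is negative.\<close>

lemma emeasure_corner_simplex_cut:
  assumes "0 < d" "0 \<le> \<alpha>" "0 \<le> \<beta>"
  shows "emeasure (lborel_box d) {v \<in> corner_simplex d 1. \<alpha> \<le> v 0 \<and> \<beta> \<le> 1 - (\<Sum>i<d. v i)}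
    = ennreal (max 0 (1 - \<alpha> - \<beta>) ^ d / fact d)"
proof (cases "1 - \<alpha> - \<beta> \<ge> 0")
  case True
  define c where "c i = (if i = 0 then \<alpha> else 0)" for i :: nat
  define C where "C = {v \<in> corner_simplex d 1. \<alpha> \<le> v 0 \<and> \<beta> \<le> 1 - (\<Sum>i<d. v i)}"
  have meas: "C \<in> sets (lborel_box d)"
    unfolding C_def by (rule sets_corner_simplex_cut[OF \<open>0 < d\<close>])
  have sum: "(\<Sum>i<d. v i + c i) = (\<Sum>i<d. v i) + \<alpha>" for v
    using \<open>0 < d\<close> by (simp add: sum.distrib c_def)
  have c0: "c 0 = \<alpha>"
    by (simp add: c_def)
  have eq: "(\<lambda>v. \<lambda>i\<in>{..<d}. v i + c i) -` C \<inter> space (lborel_box d) = corner_simplex d (1 - \<alpha> - \<beta>)"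
  proof (rule set_eqI)
    fix v
    show "v \<in> (\<lambda>v. \<lambda>i\<in>{..<d}. v i + c i) -` C \<inter> space (lborel_box d)
        \<longleftrightarrow> v \<in> corner_simplex d (1 - \<alpha> - \<beta>)"
    proof -
      have "v \<in> (\<lambda>v. \<lambda>i\<in>{..<d}. v i + c i) -` C \<inter> space (lborel_box d) \<longleftrightarrow>
          v \<in> space (lborel_box d) \<and> (\<forall>i\<in>{..<d}. 0 \<le> v i + c i) \<and>
          (\<Sum>i<d. v i) + \<alpha> \<le> 1 \<and> \<alpha> \<le> v 0 + \<alpha> \<and> \<beta> \<le> 1 - ((\<Sum>i<d. v i) + \<alpha>)"
        using \<open>0 < d\<close> c0 by (auto simp: C_def corner_simplex_def sum space_PiM)
      also have "\<dots> \<longleftrightarrow> v \<in> corner_simplex d (1 - \<alpha> - \<beta>)"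
        using assms by (auto simp: corner_simplex_def c_def split: if_splits)
      finally show ?thesis .
    qed
  qed
  have "emeasure (lborel_box d) C =
      emeasure (distr (lborel_box d) (lborel_box d) (\<lambda>v. \<lambda>i\<in>{..<d}. v i + c i)) C"
    by (simp add: distr_lborel_box_translate)
  also have "\<dots> = emeasure (lborel_box d) (corner_simplex d (1 - \<alpha> - \<beta>))"
    by (subst emeasure_distr) (use meas in \<open>auto simp: eq\<close>)
  finally show ?thesis
    using True by (simp add: C_def emeasure_corner_simplex max_def)
next
  case False
  have empty: "{v \<in> corner_simplex d 1. \<alpha> \<le> v 0 \<and> \<beta> \<le> 1 - (\<Sum>i<d. v i)} = {}"
  proof -
    have "v 0 \<le> (\<Sum>i<d. v i)" if "v \<in> corner_simplex d 1" for v
      using that \<open>0 < d\<close> by (intro member_le_sum) (auto simp: corner_simplex_def)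
    with False show ?thesis by fastforce
  qed
  \<comment> \<open>The positive dimension makes \<open>0 ^ d\<close> vanish, matching the empty
    region.\<close>
  show ?thesis
    unfolding empty using False \<open>0 < d\<close> by (simp add: max_def)
qed

text \<open>Layer-cake integration: the minimum is at least \<open>s\<close> exactly on a simplex
  cut at \<open>s / a\<close> and \<open>s / b\<close>, whose volume is known. Integrating this
  volume over \<open>s\<close> gives the result.\<close>

lemma nn_integral_min_corner_simplex:
  assumes "0 < d" "0 < a" "0 < b"
  shows "(\<integral>\<^sup>+v. ennreal (min (v 0 * a) ((1 - (\<Sum>i<d. v i)) * b)) * indicator (corner_simplex d 1) v
      \<partial>lborel_box d) = ennreal (a * b / (a + b) / fact (Suc d))"
proof -
  \<comment> \<open>Since \<open>1 / H = 1 / a + 1 / b\<close>, the superlevel set at height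
    \<open>s\<close> has size \<open>1 - s / H\<close>, and \<open>H\<close> is the maximum of the
    integrand on the simplex.\<close>
  define H where "H = a * b / (a + b)"
  have H: "H > 0" using assms by (simp add: H_def)
  interpret product_sigma_finite "\<lambda>_::nat. lborel :: real measure"
    by standard
  interpret bx: sigma_finite_measure "lborel_box d"
    by (rule sigma_finite) simp
  interpret P: pair_sigma_finite "lborel_box d" "lborel :: real measure" ..
  \<comment> \<open>\<open>?Q\<close> describes the region under the graph; its slices in
    \<open>s\<close> and in \<open>v\<close> are the two sides of the Fubini exchange.\<close>
  let ?Q = "\<lambda>v s. v \<in> corner_simplex d 1 \<and> 0 \<le> s \<and> s / a \<le> v 0 \<and> s / b \<le> 1 - (\<Sum>i<d. v i)"
  have meas: "case_prod (\<lambda>v s. indicator {(v, s). ?Q v s} (v, s) :: ennreal)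
      \<in> borel_measurable (lborel_box d \<Otimes>\<^sub>M lborel)"
  proof -
    note [measurable] = measurable_compose[OF measurable_fst measurable_sum_coordinates]
      measurable_compose[OF measurable_fst measurable_coordinate[OF \<open>0 < d\<close>]]
    have "{(v, s). ?Q v s} = corner_simplex d 1 \<times> {0..} \<inter>
        {p \<in> space (lborel_box d \<Otimes>\<^sub>M lborel).
          snd p / a \<le> fst p 0 \<and> snd p / b \<le> 1 - (\<Sum>i<d. fst p i)}"
      by (auto simp: corner_simplex_def space_pair_measure)
    also have "\<dots> \<in> sets (lborel_box d \<Otimes>\<^sub>M lborel)"
      by measurable
    finally show ?thesis
      by (simp add: case_prod_beta)
  qed
  have layer: "ennreal (min (v 0 * a) ((1 - (\<Sum>i<d. v i)) * b)) * indicator (corner_simplex d 1) v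
      = (\<integral>\<^sup>+s. indicator {(v, s). ?Q v s} (v, s) \<partial>lborel)" for v
  proof (cases "v \<in> corner_simplex d 1")
    case True
    have nonneg: "0 \<le> min (v 0 * a) ((1 - (\<Sum>i<d. v i)) * b)"
      using True assms by (auto simp: corner_simplex_def)
    have "(\<integral>\<^sup>+s. indicator {(v, s). ?Q v s} (v, s) \<partial>lborel)
        = (\<integral>\<^sup>+s. indicator {0..min (v 0 * a) ((1 - (\<Sum>i<d. v i)) * b)} s \<partial>lborel)"
      using True assms by (intro nn_integral_cong) (auto simp: indicator_def field_simps)
    also have "\<dots> = ennreal (min (v 0 * a) ((1 - (\<Sum>i<d. v i)) * b))"
      using nonneg by simp
    finally show ?thesis using True by simp
  next
    case False
    then show ?thesis by simp
  qed
  have slice: "(\<integral>\<^sup>+v. indicator {(v, s). ?Q v s} (v, s) \<partial>lborel_box d)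
      = ennreal ((1 - s / H) ^ d / fact d) * indicator {0..H} s" for s
  proof (cases "s \<ge> 0")
    case True
    have "(\<integral>\<^sup>+v. indicator {(v, s). ?Q v s} (v, s) \<partial>lborel_box d) =
        (\<integral>\<^sup>+v. indicator {v \<in> corner_simplex d 1. s / a \<le> v 0 \<and> s / b \<le> 1 - (\<Sum>i<d. v i)} v
          \<partial>lborel_box d)"
      using True by (intro nn_integral_cong) (auto simp: indicator_def)
    also have "\<dots> = emeasure (lborel_box d)
        {v \<in> corner_simplex d 1. s / a \<le> v 0 \<and> s / b \<le> 1 - (\<Sum>i<d. v i)}"
    proof (rule nn_integral_indicator)
      show "{v \<in> corner_simplex d 1. s / a \<le> v 0 \<and> s / b \<le> 1 - (\<Sum>i<d. v i)} \<in> sets (lborel_box d)"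
        by (rule sets_corner_simplex_cut[OF \<open>0 < d\<close>])
    qed
    also have "\<dots> = ennreal (max 0 (1 - s / a - s / b) ^ d / fact d)"
      using assms True by (intro emeasure_corner_simplex_cut) auto
    also have "1 - s / a - s / b = 1 - s / H"
      using assms by (simp add: H_def field_simps)
    also have "ennreal (max 0 (1 - s / H) ^ d / fact d)
        = ennreal ((1 - s / H) ^ d / fact d) * indicator {0..H} s"
      using True H \<open>0 < d\<close> by (auto simp: indicator_def max_def field_simps)
    finally show ?thesis .
  qed simp
  have "(\<integral>\<^sup>+v. ennreal (min (v 0 * a) ((1 - (\<Sum>i<d. v i)) * b)) * indicator (corner_simplex d 1) v
      \<partial>lborel_box d) = (\<integral>\<^sup>+v. \<integral>\<^sup>+s. indicator {(v, s). ?Q v s} (v, s) \<partial>lborel \<partial>lborel_box d)"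
    by (simp add: layer)
  also have "\<dots> = (\<integral>\<^sup>+s. \<integral>\<^sup>+v. indicator {(v, s). ?Q v s} (v, s) \<partial>lborel_box d \<partial>lborel)"
    using P.Fubini'[OF meas] by simp
  also have "\<dots> = (\<integral>\<^sup>+s. ennreal ((1 - s / H) ^ d / fact d) * indicator {0..H} s \<partial>lborel)"
    by (simp add: slice)
  \<comment> \<open>The antiderivative of the slice volume is evaluated at the ends; it vanishes at
    \<open>H\<close>, so only the term at 0 remains.\<close>
  also have "\<dots> = ennreal (- H * (1 - H / H) ^ Suc d / fact (Suc d) - - H * (1 - 0 / H) ^ Suc d / fact (Suc d))"
  proof (rule nn_integral_FTC_Icc)
    fix s assume s: "s \<in> {0..H}"
    have "((\<lambda>s. - H * (1 - s / H) ^ Suc d / fact (Suc d)) has_real_derivative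
        - H * (real (Suc d) * (1 - s / H) ^ d * (- (1 / H))) / fact (Suc d)) (at s)"
      by (auto intro!: derivative_eq_intros simp del: power_Suc)
    also have "- H * (real (Suc d) * (1 - s / H) ^ d * (- (1 / H))) / fact (Suc d) = (1 - s / H) ^ d / fact d"
      using H by (simp add: fact_Suc field_simps del: of_nat_Suc)
    finally show "((\<lambda>s. - H * (1 - s / H) ^ Suc d / fact (Suc d)) has_real_derivative
        (1 - s / H) ^ d / fact d) (at s)" .
    show "0 \<le> (1 - s / H) ^ d / fact d"
      using s H by (auto simp: field_simps intro!: divide_nonneg_pos zero_le_power)
  qed (use H in auto)
  also have "\<dots> = ennreal (H / fact (Suc d))"
    using H by simp
  finally show ?thesis by (simp add: H_def)
qed

lemma integrable_corner_simplex:
  fixes f :: "(nat \<Rightarrow> real) \<Rightarrow> real"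
  assumes [measurable]: "f \<in> borel_measurable (lborel_box d)"
    and bound: "\<And>v. v \<in> corner_simplex d 1 \<Longrightarrow> \<bar>f v\<bar> \<le> B"
  shows "set_integrable (lborel_box d) (corner_simplex d 1) f"
  unfolding set_integrable_def
proof (rule Bochner_Integration.integrable_bound)
  show "integrable (lborel_box d) (\<lambda>v. indicator (corner_simplex d 1) v *\<^sub>R B)"
    using emeasure_corner_simplex[of 1 d] by (intro integrable_indicator) auto
qed (auto simp: indicator_def intro!: always_eventually order.trans[OF bound])

lemma set_integral_min_corner_simplex:
  assumes "0 < d" "0 < a" "0 < b"
  shows "(LINT v:corner_simplex d 1|lborel_box d. min (v 0 * a) ((1 - (\<Sum>i<d. v i)) * b))
    = a * b / (a + b) / fact (Suc d)"
proof -
  have "(LINT v:corner_simplex d 1|lborel_box d. min (v 0 * a) ((1 - (\<Sum>i<d. v i)) * b))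
    = enn2real (\<integral>\<^sup>+v. ennreal (indicator (corner_simplex d 1) v *\<^sub>R min (v 0 * a) ((1 - (\<Sum>i<d. v i)) * b)) \<partial>lborel_box d)"
    unfolding set_lebesgue_integral_def
  proof (rule integral_eq_nn_integral)
    show "(\<lambda>v. indicator (corner_simplex d 1) v *\<^sub>R min (v 0 * a) ((1 - (\<Sum>i<d. v i)) * b))
        \<in> borel_measurable (lborel_box d)"
      using measurable_coordinate[OF \<open>0 < d\<close>] by measurable
  qed (use assms in \<open>auto simp: indicator_def corner_simplex_def intro!: always_eventually\<close>)
  also have "(\<integral>\<^sup>+v. ennreal (indicator (corner_simplex d 1) v *\<^sub>R min (v 0 * a) ((1 - (\<Sum>i<d. v i)) * b)) \<partial>lborel_box d)
    = (\<integral>\<^sup>+v. ennreal (min (v 0 * a) ((1 - (\<Sum>i<d. v i)) * b)) * indicator (corner_simplex d 1) v \<partial>lborel_box d)"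
    by (intro nn_integral_cong) (auto simp: indicator_def)
  finally show ?thesis
    using assms by (simp add: nn_integral_min_corner_simplex del: fact_Suc)
qed

section \<open>The integral on the plane of two coordinates\<close>

lemma set_integral_sum_list:
  fixes f :: "'b \<Rightarrow> 'a \<Rightarrow> real"
  assumes "\<And>x. x \<in> set xs \<Longrightarrow> set_integrable M S (f x)"
  shows "set_integrable M S (\<lambda>v. \<Sum>x\<leftarrow>xs. f x v)"
    and "(LINT v:S|M. \<Sum>x\<leftarrow>xs. f x v) = (\<Sum>x\<leftarrow>xs. LINT v:S|M. f x v)"
proof -
  have "set_integrable M S (\<lambda>v. \<Sum>x\<leftarrow>xs. f x v) \<and>
      (LINT v:S|M. \<Sum>x\<leftarrow>xs. f x v) = (\<Sum>x\<leftarrow>xs. LINT v:S|M. f x v)"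
    using assms
  proof (induction xs)
    case Nil
    then show ?case by (simp add: set_integrable_def set_lebesgue_integral_def)
  next
    case (Cons x xs)
    then show ?case by (simp add: set_integral_add)
  qed
  then show "set_integrable M S (\<lambda>v. \<Sum>x\<leftarrow>xs. f x v)"
    and "(LINT v:S|M. \<Sum>x\<leftarrow>xs. f x v) = (\<Sum>x\<leftarrow>xs. LINT v:S|M. f x v)"
    by auto
qed

text \<open>For an increasing sequence \<open>x\<close> and a decreasing sequence \<open>y\<close>, inclusion-exclusion collapses to
  \<open>min\<^sub>k max x\<^sub>k y\<^sub>k = \<Sum>\<^sub>k max x\<^sub>k y\<^sub>k - \<Sum>\<^sub>k max x\<^sub>k\<^sub>+\<^sub>1 y\<^sub>k\<close>;
  substituting \<open>max x y = x + y - min x y\<close> telescopes the linear part.\<close>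

lemma Min_max_staircase:
  fixes w0 w1 :: real
  assumes "sorted_wrt (<) zs" "zs \<noteq> []" "0 \<le> w0" "0 \<le> w1"
  shows "(MIN a\<in>set zs. max (w0 * a) (w1 * (1 - a))) =
    w0 * hd zs + w1 * (1 - last zs) + (\<Sum>(a, b)\<leftarrow>zip zs (tl zs). min (w0 * b) (w1 * (1 - a)))
    - (\<Sum>a\<leftarrow>zs. min (w0 * a) (w1 * (1 - a)))"
  using assms(1,2)
proof (induction zs rule: induct_list012)
  case (3 a b zs)
  define m where "m = (MIN a\<in>set (b # zs). max (w0 * a) (w1 * (1 - a)))"
  have lower: "w0 * b \<le> m"
    unfolding m_def
  proof (rule Min.boundedI)
    fix u assume "u \<in> (\<lambda>a. max (w0 * a) (w1 * (1 - a))) ` set (b # zs)"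
    then obtain z where z: "z \<in> set (b # zs)" "u = max (w0 * z) (w1 * (1 - z))" by blast
    then have "b \<le> z" using 3(3) by auto
    then show "w0 * b \<le> u"
      unfolding z(2) by (intro max.coboundedI1 mult_left_mono) (use assms in auto)
  qed auto
  have "m \<le> max (w0 * b) (w1 * (1 - b))"
    unfolding m_def by (rule Min_le) auto
  moreover have "w1 * (1 - b) \<le> w1 * (1 - a)" "w0 * a \<le> w0 * b"
    using 3(3) assms by (auto intro!: mult_left_mono)
  \<comment> \<open>If \<open>w1 * (1 - a)\<close> is at least \<open>w0 * b\<close>, then it bounds
    \<open>m\<close> from above, so the minimum is \<open>m\<close> and the two maxima cancel.
    Otherwise \<open>m = w0 * b\<close>, which is also the subtracted maximum.\<close>
  ultimately have "min (max (w0 * a) (w1 * (1 - a))) m =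
      max (w0 * a) (w1 * (1 - a)) + m - max (w0 * b) (w1 * (1 - a))"
    using lower by (auto simp: min_def max_def split: if_splits)
  moreover have "(MIN z\<in>set (a # b # zs). max (w0 * z) (w1 * (1 - z))) =
      min (max (w0 * a) (w1 * (1 - a))) m"
    by (simp add: m_def)
  moreover have "m = w0 * b + w1 * (1 - last (b # zs))
      + (\<Sum>(a, b)\<leftarrow>zip (b # zs) zs. min (w0 * b) (w1 * (1 - a)))
      - (\<Sum>a\<leftarrow>b # zs. min (w0 * a) (w1 * (1 - a)))"
    using 3(2,3) unfolding m_def by simp
  ultimately show ?case
    by (simp add: max_def min_def)
qed (auto simp: max_def min_def)

section \<open>Inputs with two active coordinates\<close>

definition plane_point :: "nat \<Rightarrow> real \<Rightarrow> nat \<Rightarrow> real" where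
  "plane_point N a = (\<lambda>i\<in>{..<N}. if i = 0 then a else if i = N - 1 then 1 - a else 0)"

text \<open>The zero coordinates contribute 0, which never exceeds the nonnegative product of
  coordinate 0.\<close>

lemma R2_integrand_plane_points:
  assumes "N \<ge> 2" "\<And>i. i < N \<Longrightarrow> 0 \<le> w i" "\<And>a. a \<in> A \<Longrightarrow> 0 \<le> a \<and> a \<le> 1"
  shows "R2_integrand N (plane_point N ` A) w = (MIN a\<in>A. max (w 0 * a) (w (N - 1) * (1 - a)))"
proof -
  have "(MAX i\<in>{..<N}. w i * plane_point N a i) = max (w 0 * a) (w (N - 1) * (1 - a))" if "a \<in> A" for a
  proof (rule Max_eqI)
    fix u assume "u \<in> (\<lambda>i. w i * plane_point N a i) ` {..<N}"
    then obtain i where i: "i < N" "u = w i * plane_point N a i" by auto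
    have "0 \<le> w 0 * a"
      using assms that by auto
    then show "u \<le> max (w 0 * a) (w (N - 1) * (1 - a))"
      using i by (auto simp: plane_point_def)
  next
    have "w 0 * a \<in> (\<lambda>i. w i * plane_point N a i) ` {..<N}"
      using assms(1) by (intro image_eqI[of _ _ 0]) (auto simp: plane_point_def)
    moreover have "w (N - 1) * (1 - a) \<in> (\<lambda>i. w i * plane_point N a i) ` {..<N}"
      using assms(1) by (intro image_eqI[of _ _ "N - 1"]) (auto simp: plane_point_def)
    ultimately
    show "max (w 0 * a) (w (N - 1) * (1 - a)) \<in> (\<lambda>i. w i * plane_point N a i) ` {..<N}"
      by (metis max_def)
  qed simp
  then show ?thesis
    by (simp add: R2_integrand_def image_image cong: image_cong)
qed

lemma simplex_chart_mem_std_simplex: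
  assumes "N > 0" "v \<in> space (lborel_box (N - 1))"
  shows "simplex_chart N v \<in> std_simplex N \<longleftrightarrow> v \<in> corner_simplex (N - 1) 1"
proof -
  obtain d where N: "N = Suc d" using assms(1) by (cases N) auto
  \<comment> \<open>The chart overwrites only index \<open>d\<close>, so its value is undefined from
    \<open>N\<close> on, as extensionality on \<open>{..<N}\<close> demands.\<close>
  have "v i = undefined" if "i \<ge> d" for i
    using assms(2) that by (auto simp: N space_PiM PiE_def extensional_def)
  then show ?thesis
    using assms(2)
    by (auto simp: N simplex_chart_def std_simplex_def nonneg_vectors_def corner_simplex_def
        PiE_iff extensional_def less_Suc_eq lessThan_Suc)
qed

text \<open>The list \<open>zs\<close> is meant to be increasing. The last sum has the summand of
  the first at \<open>b = a\<close>, where the denominator is 1, so only adjacent pairs can produce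
  poles.\<close>

definition staircase_value :: "real \<Rightarrow> real \<Rightarrow> real \<Rightarrow> real list \<Rightarrow> real" where
  "staircase_value \<alpha> \<beta> \<gamma> zs = \<alpha> * hd zs + \<beta> * (1 - last zs)
    + \<gamma> * ((\<Sum>(a, b)\<leftarrow>zip zs (tl zs). b * (1 - a) / (b + (1 - a))) - (\<Sum>a\<leftarrow>zs. a * (1 - a)))"

text \<open>The staircase identity is integrated term by term. The constants are chosen before
  \<open>zs\<close>, so they depend on \<open>N\<close> alone and are common to all order
  cells.\<close>

lemma R2_normalized_plane_points:
  assumes "N \<ge> 2"
  shows "\<exists>\<alpha> \<beta> \<gamma>. \<gamma> \<noteq> 0 \<and> (\<forall>zs. sorted_wrt (<) zs \<and> zs \<noteq> [] \<and> set zs \<subseteq> {0<..<1} \<longrightarrow>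
    R2_normalized N (plane_point N ` set zs) = staircase_value \<alpha> \<beta> \<gamma> zs)"
proof -
  define d where "d = N - 1"
  have d: "0 < d" "N - 1 = d" "N = Suc d" using assms by (auto simp: d_def)
  let ?M = "lborel_box d" and ?S = "corner_simplex d 1"
  define w1 where "w1 v = 1 - (\<Sum>i<d. v i)" for v :: "nat \<Rightarrow> real"
  note [measurable] = measurable_coordinate[OF d(1)]
  have w1_meas [measurable]: "w1 \<in> borel_measurable ?M"
    unfolding w1_def by measurable
  have w0: "0 \<le> v 0 \<and> v 0 \<le> 1" and w1: "0 \<le> w1 v \<and> w1 v \<le> 1" if "v \<in> ?S" for v
  proof -
    have "v 0 \<le> (\<Sum>i<d. v i)" "0 \<le> (\<Sum>i<d. v i)"
      using that d(1) by (auto simp: corner_simplex_def intro!: member_le_sum sum_nonneg)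
    then show "0 \<le> v 0 \<and> v 0 \<le> 1" "0 \<le> w1 v \<and> w1 v \<le> 1"
      using that d(1) by (auto simp: corner_simplex_def w1_def)
  qed
  \<comment> \<open>The first moments of the two weights, left unevaluated, account for the boundary
    terms.\<close>
  define \<mu>0 where "\<mu>0 = (LINT v:?S|?M. v 0)"
  define \<mu>1 where "\<mu>1 = (LINT v:?S|?M. w1 v)"
  have int0: "set_integrable ?M ?S (\<lambda>v. v 0)"
    using w0 by (intro integrable_corner_simplex[where B = 1]) auto
  have int1: "set_integrable ?M ?S w1"
    using w1 by (intro integrable_corner_simplex[where B = 1]) auto
  have int_min: "set_integrable ?M ?S (\<lambda>v. min (v 0 * a) (w1 v * b))"
    and lint_min: "(LINT v:?S|?M. min (v 0 * a) (w1 v * b)) = a * b / (a + b) / fact N"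
    if "0 < a" "0 < b" for a b
  proof -
    show "set_integrable ?M ?S (\<lambda>v. min (v 0 * a) (w1 v * b))"
    proof (rule integrable_corner_simplex[where B = a])
      fix v assume v: "v \<in> ?S"
      have "v 0 * a \<le> 1 * a"
        using w0[OF v] that by (intro mult_right_mono) auto
      moreover have "0 \<le> min (v 0 * a) (w1 v * b)"
        using w0[OF v] w1[OF v] that by simp
      ultimately show "\<bar>min (v 0 * a) (w1 v * b)\<bar> \<le> a" by linarith
    qed measurable
    show "(LINT v:?S|?M. min (v 0 * a) (w1 v * b)) = a * b / (a + b) / fact N"
      using set_integral_min_corner_simplex[OF d(1) that] d(3) by (simp add: w1_def)
  qed
  have "R2_normalized N (plane_point N ` set zs)
      = staircase_value (fact d * \<mu>0) (fact d * \<mu>1) (fact d / fact N) zs"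
    if zs: "sorted_wrt (<) zs" "zs \<noteq> []" "set zs \<subseteq> {0<..<1}" for zs
  proof -
    let ?F = "\<lambda>v. \<Sum>p\<leftarrow>zip zs (tl zs). min (v 0 * snd p) (w1 v * (1 - fst p))"
    let ?P = "\<Sum>p\<leftarrow>zip zs (tl zs). snd p * (1 - fst p) / (snd p + (1 - fst p))"
    let ?Q = "\<Sum>a\<leftarrow>zs. a * (1 - a)"
    let ?G = "\<lambda>v. \<Sum>a\<leftarrow>zs. min (v 0 * a) (w1 v * (1 - a))"
    have mem: "0 < fst p \<and> fst p < 1 \<and> 0 < snd p \<and> snd p < 1" if "p \<in> set (zip zs (tl zs))" for p
    proof -
      have "fst p \<in> set zs" "snd p \<in> set (tl zs)"
        using that set_zip_leftD[of "fst p" "snd p"] set_zip_rightD[of "fst p" "snd p"] by auto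
      then have "fst p \<in> set zs" "snd p \<in> set zs"
        using zs(2) by (auto intro: list.set_sel(2))
      then show ?thesis using zs(3) by auto
    qed
    have "(LINT v : simplex_chart N -` std_simplex N | ?M.
          R2_integrand N (plane_point N ` set zs) (simplex_chart N v))
        = (LINT v:?S|?M. (v 0 * hd zs + w1 v * (1 - last zs)) + ?F v - ?G v)"
      unfolding set_lebesgue_integral_def
    proof (rule Bochner_Integration.integral_cong[OF refl])
      fix v assume v: "v \<in> space ?M"
      have eq: "R2_integrand N (plane_point N ` set zs) (simplex_chart N v)
          = (v 0 * hd zs + w1 v * (1 - last zs)) + ?F v - ?G v" if S: "v \<in> ?S"
      proof -
        have nonneg: "0 \<le> simplex_chart N v i" if "i < N" for i
          using S v simplex_chart_mem_std_simplex[of N v] assms that d(2)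
          by (auto simp: std_simplex_def nonneg_vectors_def)
        have "R2_integrand N (plane_point N ` set zs) (simplex_chart N v)
            = (MIN a\<in>set zs. max (v 0 * a) (w1 v * (1 - a)))"
          using zs(3) nonneg assms d
          by (subst R2_integrand_plane_points) (auto simp: simplex_chart_def w1_def subset_iff less_imp_le)
        also have "\<dots> = (v 0 * hd zs + w1 v * (1 - last zs)) + ?F v - ?G v"
          using Min_max_staircase[OF zs(1,2), of "v 0" "w1 v"] w0[OF S] w1[OF S]
          unfolding case_prod_beta by blast
        finally show ?thesis .
      qed
      have "v \<in> simplex_chart N -` std_simplex N \<longleftrightarrow> v \<in> ?S"
        using simplex_chart_mem_std_simplex[of N v] v assms d(2) by simp
      with eq show "indicat_real (simplex_chart N -` std_simplex N) v *\<^sub>R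
            R2_integrand N (plane_point N ` set zs) (simplex_chart N v)
          = indicat_real ?S v *\<^sub>R ((v 0 * hd zs + w1 v * (1 - last zs)) + ?F v - ?G v)"
        by (simp add: indicator_def)
    qed
    also have "\<dots> = (\<mu>0 * hd zs + \<mu>1 * (1 - last zs))
        + (\<Sum>p\<leftarrow>zip zs (tl zs). snd p * (1 - fst p) / (snd p + (1 - fst p)) / fact N)
        - (\<Sum>a\<leftarrow>zs. a * (1 - a) / fact N)"
    proof -
      have lin: "set_integrable ?M ?S (\<lambda>v. v 0 * hd zs + w1 v * (1 - last zs))"
        "(LINT v:?S|?M. v 0 * hd zs + w1 v * (1 - last zs)) = \<mu>0 * hd zs + \<mu>1 * (1 - last zs)"
        using int0 int1 by (simp_all add: set_integral_add \<mu>0_def \<mu>1_def)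
      have intF: "set_integrable ?M ?S (\<lambda>v. min (v 0 * snd p) (w1 v * (1 - fst p)))"
        if "p \<in> set (zip zs (tl zs))" for p
        using mem[OF that] by (intro int_min) auto
      have intG: "set_integrable ?M ?S (\<lambda>v. min (v 0 * a) (w1 v * (1 - a)))" if "a \<in> set zs" for a
        using zs(3) that by (intro int_min) auto
      have sumF: "set_integrable ?M ?S ?F" "(LINT v:?S|?M. ?F v)
          = (\<Sum>p\<leftarrow>zip zs (tl zs). LINT v:?S|?M. min (v 0 * snd p) (w1 v * (1 - fst p)))"
        using intF by (intro set_integral_sum_list, blast)+
      have sumG: "set_integrable ?M ?S ?G" "(LINT v:?S|?M. ?G v)
          = (\<Sum>a\<leftarrow>zs. LINT v:?S|?M. min (v 0 * a) (w1 v * (1 - a)))"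
        using intG by (intro set_integral_sum_list, blast)+
      have F: "(LINT v:?S|?M. ?F v)
          = (\<Sum>p\<leftarrow>zip zs (tl zs). snd p * (1 - fst p) / (snd p + (1 - fst p)) / fact N)"
        unfolding sumF(2)
        by (intro arg_cong[where f = sum_list] map_cong refl lint_min) (use mem in auto)
      \<comment> \<open>Here \<open>a + (1 - a) = 1\<close> removes the denominator.\<close>
      have G: "(LINT v:?S|?M. ?G v) = (\<Sum>a\<leftarrow>zs. a * (1 - a) / fact N)"
        unfolding sumG(2)
        by (intro arg_cong[where f = sum_list] map_cong refl) (use zs(3) in \<open>auto simp: lint_min\<close>)
      show ?thesis
        using set_integral_diff(2)[OF set_integral_add(1)[OF lin(1) sumF(1)] sumG(1)]
          set_integral_add(2)[OF lin(1) sumF(1)]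
        unfolding F G lin(2) by simp
    qed
    finally have lint: "(LINT v : simplex_chart N -` std_simplex N | ?M.
          R2_integrand N (plane_point N ` set zs) (simplex_chart N v))
        = (\<mu>0 * hd zs + \<mu>1 * (1 - last zs)) + ?P * inverse (fact N) - ?Q * inverse (fact N)"
      by (simp only: divide_inverse[of _ "fact N"] sum_list_mult_const)
    have "staircase_value (fact d * \<mu>0) (fact d * \<mu>1) (fact d / fact N) zs
        = fact d * \<mu>0 * hd zs + fact d * \<mu>1 * (1 - last zs) + fact d / fact N * (?P - ?Q)"
      unfolding staircase_value_def case_prod_beta ..
    also have "\<dots> = fact d *
        ((\<mu>0 * hd zs + \<mu>1 * (1 - last zs)) + ?P * inverse (fact N) - ?Q * inverse (fact N))"
      unfolding divide_inverse[of _ "fact N"] ring_distribs by (simp only: mult_ac)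
    finally show ?thesis
      unfolding R2_normalized_def d(2) lint by simp
  qed
  then show ?thesis
    by (intro exI[of _ "fact d * \<mu>0"] exI[of _ "fact d * \<mu>1"] exI[of _ "fact d / fact N"]) simp
qed

section \<open>Separating the orders of the input\<close>

definition plane_input :: "nat \<Rightarrow> nat \<Rightarrow> (nat \<Rightarrow> real) \<Rightarrow> real list" where
  "plane_input N n x = input_registers N (map (\<lambda>k. plane_point N (x k)) [0..<n])"

lemma plane_input_conv_product:
  "plane_input N n x = map (\<lambda>(k, i). plane_point N (x k) i) (List.product [0..<n] [0..<N])"
  by (simp add: plane_input_def input_registers_def product_concat_map map_concat o_def)

lemma length_plane_input: "length (plane_input N n x) = n * N"
  by (simp add: plane_input_conv_product)

text \<open>The indices \<open>k\<close> and \<open>i\<close> are fixed before \<open>x\<close>: a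
  register position always holds the same coordinate of the same point, hence one fixed affine
  function of \<open>x k\<close>.\<close>

lemma plane_input_nth:
  assumes "r < n * N"
  shows "\<exists>k i. i < N \<and> (\<forall>x. plane_input N n x ! r = plane_point N (x k) i)"
proof -
  obtain k i where ki: "List.product [0..<n] [0..<N] ! r = (k, i)"
    by fastforce
  have "(k, i) \<in> set (List.product [0..<n] [0..<N])"
    using assms ki nth_mem[of r "List.product [0..<n] [0..<N]"] by simp
  then have "i < N" by simp
  moreover have "plane_input N n x ! r = plane_point N (x k) i" for x
    using assms by (simp add: plane_input_conv_product ki)
  ultimately show ?thesis by blast
qed

lemma plane_point_cases:
  assumes "i < N"
  shows "(\<forall>a. plane_point N a i = a) \<or> (\<forall>a. plane_point N a i = 1 - a) \<or> (\<forall>a. plane_point N a i = 0)"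
  using assms by (simp add: plane_point_def)

text \<open>The list \<open>xs\<close> names the input indices in increasing order of value. Points
  are functions on all of \<open>nat\<close> with the product topology, and only finitely many
  coordinates are constrained.\<close>

definition order_cell :: "nat list \<Rightarrow> (nat \<Rightarrow> real) set" where
  "order_cell xs = {x. sorted_wrt (<) (map x xs) \<and> (\<forall>k\<in>set xs. 0 < x k \<and> x k < 1)}"

lemma open_order_cell: "open (order_cell xs)"
proof -
  have ball: "open {x :: nat \<Rightarrow> real. \<forall>k\<in>set us. P k x}" if "\<And>k. open {x. P k x}" for us P
    using open_INT[of "set us" "\<lambda>k. {x. P k x}"] that by (simp add: Collect_ball_eq)
  have "open {x :: nat \<Rightarrow> real. sorted_wrt (<) (map x xs)}"
    by (induction xs) (auto intro!: open_Collect_conj ball open_Collect_less)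
  moreover have "open {x :: nat \<Rightarrow> real. \<forall>k\<in>set xs. 0 < x k \<and> x k < 1}"
    by (auto intro!: open_Collect_conj ball open_Collect_less)
  ultimately show ?thesis
    unfolding order_cell_def by (rule open_Collect_conj)
qed

lemma order_cell_nonempty:
  assumes "distinct xs"
  shows "order_cell xs \<noteq> {}"
proof -
  \<comment> \<open>Each index receives its rank in \<open>xs\<close>, counted from 1 and divided by
    one more than the length, so that all values lie strictly between 0 and 1.\<close>
  define x where "x k = real (Suc (the_inv_into {..<length xs} ((!) xs) k)) / real (Suc (length xs))" for k
  have x: "x (xs ! i) = real (Suc i) / real (Suc (length xs))" if "i < length xs" for i
    using assms that by (simp add: x_def the_inv_into_f_f inj_on_nth)
  have "x \<in> order_cell xs"
    by (auto simp: order_cell_def sorted_wrt_iff_nth_less in_set_conv_nth x divide_strict_right_mono)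
  then show ?thesis by blast
qed

lemma sorted_wrt_adjacent_imp:
  fixes x :: "'a \<Rightarrow> real"
  assumes "\<And>i j. (i, j) \<in> set (zip xs (tl xs)) \<Longrightarrow> x i < x j"
  shows "sorted_wrt (<) (map x xs)"
  using assms
proof (induction xs rule: induct_list012)
  case (3 a b xs)
  then have "sorted_wrt (<) (map x (b # xs))" "x a < x b" by auto
  then show ?case by auto
qed auto

lemma sorted_wrt_adjacent:
  fixes x :: "'a \<Rightarrow> real"
  shows "sorted_wrt (<) (map x xs) \<Longrightarrow> (i, j) \<in> set (zip xs (tl xs)) \<Longrightarrow> x i < x j"
  by (induction xs rule: induct_list012) auto

text \<open>A point in the cell of \<open>ys\<close> increases along every adjacent pair of
  \<open>xs\<close>, hence along all of \<open>xs\<close>; both lists then sort the same values. The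
  contrapositive supplies a pair adjacent in one order but not in the other.\<close>

lemma adjacent_pairs_determine_list:
  assumes "set xs = set ys" "distinct ys" "set (zip xs (tl xs)) \<subseteq> set (zip ys (tl ys))"
  shows "xs = (ys :: nat list)"
proof -
  obtain x where x: "x \<in> order_cell ys"
    using order_cell_nonempty[OF assms(2)] by blast
  then have ys: "sorted_wrt (<) (map x ys)" by (simp add: order_cell_def)
  have xs: "sorted_wrt (<) (map x xs)"
    using sorted_wrt_adjacent[OF ys] assms(3) by (intro sorted_wrt_adjacent_imp) blast
  have eq: "map x xs = map x ys"
    using xs ys assms(1) by (intro sorted_distinct_set_unique)
      (auto simp: strict_sorted_iff)
  moreover have "inj_on x (set ys)"
    using ys by (simp add: strict_sorted_iff distinct_map)
  ultimately show ?thesis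
    using assms(1) by (metis map_inj_on Un_absorb)
qed

abbreviation pair_term :: "(nat \<Rightarrow> real) \<Rightarrow> nat \<times> nat \<Rightarrow> real" where
  "pair_term x p \<equiv> x (snd p) * (1 - x (fst p)) / (x (snd p) + (1 - x (fst p)))"

text \<open>Distinctness turns the list sums into sums over sets, so that one pair can be split off
  and the sum over all indices becomes independent of the order.\<close>

lemma staircase_value_map:
  assumes "xs \<noteq> []" "distinct xs"
  shows "staircase_value \<alpha> \<beta> \<gamma> (map x xs) = \<alpha> * x (hd xs) + \<beta> * (1 - x (last xs))
    + \<gamma> * ((\<Sum>p\<in>set (zip xs (tl xs)). pair_term x p) - (\<Sum>k\<in>set xs. x k * (1 - x k)))"
proof -
  have "zip (map x xs) (tl (map x xs)) = map (map_prod x x) (zip xs (tl xs))"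
    by (simp add: map_tl[symmetric] zip_map_map map_prod_def)
  then have "(\<Sum>(a, b)\<leftarrow>zip (map x xs) (tl (map x xs)). b * (1 - a) / (b + (1 - a)))
      = (\<Sum>p\<leftarrow>zip xs (tl xs). pair_term x p)"
    by (simp only: map_map) (rule arg_cong[where f = sum_list], rule map_cong, auto)
  also have "\<dots> = (\<Sum>p\<in>set (zip xs (tl xs)). pair_term x p)"
    using assms(2) by (intro sum_list_distinct_conv_sum_set distinct_zipI1)
  finally show ?thesis
    using assms by (simp add: staircase_value_def hd_map last_map o_def
        sum_list_distinct_conv_sum_set del: map_tl)
qed

text \<open>The registers are filled by index, not by size; the value depends only on the set of
  points, which \<open>xs\<close> lists in sorted order.\<close>

lemma run_plane_input:
  assumes "computes_R2 N n T" "N \<ge> 2" "n > 0" "set xs = {..<n}" "x \<in> order_cell xs"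
    and R2: "\<And>zs. sorted_wrt (<) zs \<and> zs \<noteq> [] \<and> set zs \<subseteq> {0<..<1} \<Longrightarrow>
      R2_normalized N (plane_point N ` set zs) = staircase_value \<alpha> \<beta> \<gamma> zs"
  shows "run T (plane_input N n x) = Some (staircase_value \<alpha> \<beta> \<gamma> (map x xs))"
proof -
  let ?ps = "map (\<lambda>k. plane_point N (x k)) [0..<n]"
  have sorted: "sorted_wrt (<) (map x xs)" and range: "\<And>k. k < n \<Longrightarrow> 0 < x k \<and> x k < 1"
    using assms(4,5) by (auto simp: order_cell_def)
  have "inj_on x {..<n}"
    using sorted assms(4) by (simp add: strict_sorted_iff distinct_map)
  moreover have "inj (plane_point N)"
    using assms(2) by (intro injI) (auto simp: plane_point_def dest!: fun_cong[where x = 0])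
  ultimately have "distinct ?ps"
    by (auto simp: distinct_map inj_on_def)
  moreover have "set ?ps \<subseteq> nonneg_vectors N"
    using range by (auto simp: nonneg_vectors_def plane_point_def less_imp_le split: if_splits)
  ultimately have "run T (plane_input N n x) = Some (R2_normalized N (set ?ps))"
    using assms(1) unfolding computes_R2_def plane_input_def by simp
  also have "set ?ps = plane_point N ` set (map x xs)"
    using assms(4) by auto
  also have "R2_normalized N \<dots> = staircase_value \<alpha> \<beta> \<gamma> (map x xs)"
  proof (rule R2, intro conjI)
    show "map x xs \<noteq> []"
      using assms(3,4) by fastforce
    show "set (map x xs) \<subseteq> {0<..<1}"
      using range unfolding set_map assms(4) by auto
  qed (rule sorted)
  finally show ?thesis .
qed

lemma eventually_at_of_cofinite:
  fixes a :: "'a::t1_space"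
  assumes "eventually P cofinite"
  shows "eventually P (at a)"
proof -
  have "open (- ({t. \<not> P t} - {a}))"
    using assms by (intro open_Compl finite_imp_closed) (simp add: eventually_cofinite)
  then show ?thesis
    unfolding eventually_at_topological by (intro exI[of _ "- ({t. \<not> P t} - {a})"]) auto
qed

text \<open>On a curve through both open sets the leaf computes one rational function, which must
  equal both staircase values. A pair adjacent in \<open>xs\<close> but not in \<open>ys\<close>
  gives only one of them a pole at a suitable parameter.\<close>

lemma leaves_separate_orders:
  assumes L: "L \<in> straight T"
    and xs: "set xs = {..<n}" "distinct xs" and ys: "set ys = {..<n}" "distinct ys"
    and "xs \<noteq> ys" "\<gamma> \<noteq> 0"
    and V: "open V" "V \<noteq> {}" "V \<subseteq> order_cell xs"
      "\<And>x. x \<in> V \<Longrightarrow> run L (plane_input N n x) = Some (staircase_value \<alpha> \<beta> \<gamma> (map x xs))"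
    and W: "open W" "W \<noteq> {}"
      "\<And>x. x \<in> W \<Longrightarrow> run L (plane_input N n x) = Some (staircase_value \<alpha> \<beta> \<gamma> (map x ys))"
  shows False
proof -
  have ne: "xs \<noteq> []" "ys \<noteq> []"
    using xs(1) ys(1) \<open>xs \<noteq> ys\<close> by (metis set_empty)+
  obtain i j where ij: "(i, j) \<in> set (zip xs (tl xs))" "(i, j) \<notin> set (zip ys (tl ys))"
  proof -
    have "\<not> set (zip xs (tl xs)) \<subseteq> set (zip ys (tl ys))"
      using adjacent_pairs_determine_list[of xs ys] xs ys \<open>xs \<noteq> ys\<close> by auto
    then show ?thesis using that by (meson subrelI)
  qed
  obtain p q where p: "p \<in> V" and q: "q \<in> W"
    using V W by blast
  have pij: "p i < p j" "0 < p j" "p i < 1"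
  proof -
    have "sorted_wrt (<) (map p xs)" "\<forall>k\<in>set xs. 0 < p k \<and> p k < 1"
      using p V(3) by (auto simp: order_cell_def)
    moreover have "i \<in> set xs" "j \<in> set xs"
      using ij(1) ne by (auto dest: set_zip_leftD set_zip_rightD intro: list.set_sel(2))
    ultimately show "p i < p j" "0 < p j" "p i < 1"
      using sorted_wrt_adjacent[OF _ ij(1)] by auto
  qed
  then have "i \<noteq> j" by auto
  txt \<open>A parabola through both cells and, at time 2, through a point at which the denominator
    of the \<open>(i, j)\<close> term vanishes but no other one does.\<close>
  define c :: "nat \<Rightarrow> real" where "c k = (if k = i then 2 else if k = j then 1 else 3 / 2)" for k
  \<comment> \<open>Half the second difference of \<open>p k\<close>, \<open>q k\<close>,
    \<open>c k\<close>, which makes \<open>P k\<close> interpolate them at 0, 1 and 2.\<close>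
  define h where "h k = (c k - 2 * q k + p k) / 2" for k
  define P where "P k = [:p k, q k - p k - h k, h k:]" for k
  define z where "z t k = poly (P k) t" for t k
  have z: "z 0 = p" "z 1 = q" "z 2 = c"
    by (auto simp: z_def P_def h_def field_simps)
  have cont: "continuous_on UNIV (\<lambda>t. z t k)" for k
    unfolding z_def by (intro continuous_intros)
  have isCont: "isCont (\<lambda>t. z t k) t" for k t
    using cont[of k] by (simp add: continuous_on_eq_continuous_at)
  have rat_z: "rational_fun (\<lambda>t. z t k)" for k
    unfolding z_def by (rule rational_fun_poly)
  have rat_pair: "rational_fun (\<lambda>t. pair_term (z t) pr)" for pr
    by (intro rational_fun_divide rational_fun_mult rational_fun_add rational_fun_diff
        rational_fun_const rat_z)
  have rat_F: "rational_fun (\<lambda>t. staircase_value \<alpha> \<beta> \<gamma> (map (z t) us))"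
    if "us \<noteq> []" "distinct us" for us
    unfolding staircase_value_map[OF that]
    by (intro rational_fun_mult rational_fun_add rational_fun_diff rational_fun_sum
        rational_fun_const rat_z rat_pair)
  have rat_in: "rational_fun (\<lambda>t. plane_input N n (z t) ! r)" if r: "r < n * N" for r
  proof -
    obtain k l where kl: "l < N" "\<And>x. plane_input N n x ! r = plane_point N (x k) l"
      using plane_input_nth[OF r] by blast
    from plane_point_cases[OF kl(1)] show ?thesis
      by (elim disjE) (auto simp: kl(2) intro: rat_z rational_fun_const rational_fun_diff)
  qed
  have extend: "\<forall>\<^sub>F t in cofinite. run L (plane_input N n (z t))
      = Some (staircase_value \<alpha> \<beta> \<gamma> (map (z t) us))"
    if us: "us \<noteq> []" "distinct us" and U: "open U" "z t\<^sub>0 \<in> U"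
      "\<And>x. x \<in> U \<Longrightarrow> run L (plane_input N n x) = Some (staircase_value \<alpha> \<beta> \<gamma> (map x us))"
    for us U t\<^sub>0
  proof (rule straight_run_rational_extend[OF L _ rat_in rat_F[OF us]])
    \<comment> \<open>A nonempty open set of parameters is infinite, as the extension lemma
      requires.\<close>
    have "open (z -` U)"
      using U(1) cont by (intro open_vimage continuous_on_coordinatewise_then_product)
    then show "infinite (z -` U)"
      using U(2) finite_imp_not_open[of "z -` U"] by blast
  qed (use U(3) in \<open>auto simp: length_plane_input\<close>)
  have "z 0 \<in> V" "z 1 \<in> W"
    using p q by (simp_all add: z)
  then have "\<forall>\<^sub>F t in cofinite. run L (plane_input N n (z t))
        = Some (staircase_value \<alpha> \<beta> \<gamma> (map (z t) xs))"
    and "\<forall>\<^sub>F t in cofinite. run L (plane_input N n (z t))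
        = Some (staircase_value \<alpha> \<beta> \<gamma> (map (z t) ys))"
    using extend[OF ne(1) xs(2) V(1)] V(4) extend[OF ne(2) ys(2) W(1)] W(3) by blast+
  then have eq: "\<forall>\<^sub>F t in cofinite.
      staircase_value \<alpha> \<beta> \<gamma> (map (z t) xs) = staircase_value \<alpha> \<beta> \<gamma> (map (z t) ys)"
    by eventually_elim simp
  define A where "A = set (zip xs (tl xs)) - {(i, j)}"
  \<comment> \<open>The difference of the two values without the \<open>(i, j)\<close> term; the
    sums over all indices cancel because both lists have the same set.\<close>
  define C where "C t = \<alpha> * (z t (hd xs) - z t (hd ys)) + \<beta> * (z t (last ys) - z t (last xs))
    + \<gamma> * ((\<Sum>pr\<in>A. pair_term (z t) pr) - (\<Sum>pr\<in>set (zip ys (tl ys)). pair_term (z t) pr))" for t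
  define den where "den t = z t j + (1 - z t i)" for t
  have den_poly: "den t = poly (P j + 1 - P i) t" for t
    by (simp add: den_def z_def)
  \<comment> \<open>At time 0 the curve is in the cell of \<open>xs\<close>, where the denominator
    is positive; hence it is not the zero polynomial.\<close>
  have "den 0 \<noteq> 0"
    using pij by (simp add: den_def z)
  then have "P j + 1 - P i \<noteq> 0"
    unfolding den_poly by (metis poly_0)
  then have den: "\<forall>\<^sub>F t in cofinite. den t \<noteq> 0"
    unfolding den_poly by (rule eventually_poly_neq_0)
  have split: "(\<Sum>pr\<in>set (zip xs (tl xs)). pair_term x pr) = pair_term x (i, j) + (\<Sum>pr\<in>A. pair_term x pr)" for x
    unfolding A_def using ij(1) by (intro sum.remove) auto
  have "\<forall>\<^sub>F t in cofinite. \<gamma> * (z t j * (1 - z t i)) + C t * den t = 0"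
    using eq den
  proof eventually_elim
    case (elim t)
    have "\<gamma> * (z t j * (1 - z t i) / den t) + C t = 0"
      using elim(1) unfolding staircase_value_map[OF ne(1) xs(2)] staircase_value_map[OF ne(2) ys(2)]
        split xs(1) ys(1)
      by (simp add: C_def den_def algebra_simps)
    with elim(2) show ?case
      by (simp add: field_simps)
  qed
  \<comment> \<open>Multiplying by \<open>den\<close> has removed the pole, so the identity passes
    to the limit at 2, where it need not have held beforehand.\<close>
  then have "\<forall>\<^sub>F t in at 2. \<gamma> * (z t j * (1 - z t i)) + C t * den t = 0"
    by (rule eventually_at_of_cofinite)
  then have "((\<lambda>t. \<gamma> * (z t j * (1 - z t i)) + C t * den t) \<longlongrightarrow> 0) (at 2)"
    by (rule tendsto_eventually)
  moreover have "isCont (\<lambda>t. \<gamma> * (z t j * (1 - z t i)) + C t * den t) 2"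
  proof -
    \<comment> \<open>The values of \<open>c\<close> are 1, 3/2 and 2, so the difference between the
      first and second index is 1 only for \<open>(i, j)\<close>.\<close>
    have nz: "z 2 (snd pr) + (1 - z 2 (fst pr)) \<noteq> 0" if "pr \<noteq> (i, j)" for pr
      using that by (cases pr) (auto simp: z(3) c_def)
    have "isCont C 2"
      unfolding C_def by (intro continuous_intros isCont nz) (use ij(2) in \<open>auto simp: A_def\<close>)
    then show ?thesis
      unfolding den_def by (intro continuous_intros isCont)
  qed
  ultimately have "\<gamma> * (z 2 j * (1 - z 2 i)) + C 2 * den 2 = 0"
    by (metis isCont_def tendsto_unique at_neq_bot)
  \<comment> \<open>At time 2 the identity reads - \<gamma> = 0, since \<open>den 2 = 0\<close>,
    \<open>c j = 1\<close> and \<open>c i = 2\<close>.\<close>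
  then show False
    using \<open>\<gamma> \<noteq> 0\<close> \<open>i \<noteq> j\<close> by (simp add: den_def z(3) c_def)
qed

text \<open>Each permutation selects a path that outputs the right value on a nonempty open part of
  its cell. By separation the selection is injective, so the number of paths bounds
  \<open>fact n\<close>.\<close>

lemma fact_le_three_power_depth:
  assumes "N \<ge> 2" "computes_R2 N n T" "n > 0"
  shows "(fact n :: nat) \<le> 3 ^ depth T"
proof -
  obtain \<alpha> \<beta> \<gamma> where \<gamma>: "\<gamma> \<noteq> 0" and
    R2: "\<And>zs. sorted_wrt (<) zs \<and> zs \<noteq> [] \<and> set zs \<subseteq> {0<..<1} \<Longrightarrow>
      R2_normalized N (plane_point N ` set zs) = staircase_value \<alpha> \<beta> \<gamma> zs"
    using R2_normalized_plane_points[OF assms(1)] by blast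
  define Perms where "Perms = permutations_of_set {..<n}"
  have perm: "set xs = {..<n}" "distinct xs" if "xs \<in> Perms" for xs
    using that by (auto simp: Perms_def dest: permutations_of_setD)
  have leaf: "\<exists>L. L \<in> straight T \<and> (\<exists>V\<subseteq>order_cell xs. open V \<and> V \<noteq> {} \<and>
      (\<forall>x\<in>V. run L (plane_input N n x) = Some (staircase_value \<alpha> \<beta> \<gamma> (map x xs))))"
    if "xs \<in> Perms" for xs
  proof -
    have run: "run T (plane_input N n x) = Some (staircase_value \<alpha> \<beta> \<gamma> (map x xs))"
      if "x \<in> order_cell xs" for x
      by (rule run_plane_input[OF assms(2,1,3) perm(1)[OF \<open>xs \<in> Perms\<close>] that]) (rule R2)
    have "\<exists>L\<in>straight T. \<exists>V\<subseteq>order_cell xs. open V \<and> V \<noteq> {} \<and>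
        (\<forall>x\<in>V. run T (plane_input N n x) = run L (plane_input N n x))"
    proof (rule run_eq_straight_on_open[OF open_order_cell order_cell_nonempty])
      show "continuous_on (order_cell xs) (\<lambda>x. plane_input N n x ! r)" if r: "r < n * N" for r
      proof -
        obtain k l where kl: "l < N" "\<And>x. plane_input N n x ! r = plane_point N (x k) l"
          using plane_input_nth[OF r] by blast
        have "continuous_on (order_cell xs) (\<lambda>x. x k)"
          by (rule continuous_on_subset[OF continuous_on_product_coordinates subset_UNIV])
        then show ?thesis
          using plane_point_cases[OF kl(1)] by (elim disjE) (auto simp: kl(2) intro!: continuous_intros)
      qed
    qed (simp_all add: run perm(2)[OF that] length_plane_input)
    then obtain L V where LV: "L \<in> straight T" "V \<subseteq> order_cell xs" "open V" "V \<noteq> {}"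
      "\<forall>x\<in>V. run T (plane_input N n x) = run L (plane_input N n x)"
      by blast
    have "\<forall>x\<in>V. run L (plane_input N n x) = Some (staircase_value \<alpha> \<beta> \<gamma> (map x xs))"
      using LV(2,5) run by (simp add: subset_iff)
    with LV show ?thesis by blast
  qed
  then obtain leaf_of where leaf_of: "\<And>xs. xs \<in> Perms \<Longrightarrow> leaf_of xs \<in> straight T"
    "\<And>xs. xs \<in> Perms \<Longrightarrow> \<exists>V\<subseteq>order_cell xs. open V \<and> V \<noteq> {} \<and>
      (\<forall>x\<in>V. run (leaf_of xs) (plane_input N n x) = Some (staircase_value \<alpha> \<beta> \<gamma> (map x xs)))"
    by metis
  have "inj_on leaf_of Perms"
  proof (rule inj_onI, rule ccontr)
    fix xs ys assume *: "xs \<in> Perms" "ys \<in> Perms" "leaf_of xs = leaf_of ys" "xs \<noteq> ys"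
    obtain V where V: "V \<subseteq> order_cell xs" "open V" "V \<noteq> {}"
      "\<And>x. x \<in> V \<Longrightarrow> run (leaf_of xs) (plane_input N n x) = Some (staircase_value \<alpha> \<beta> \<gamma> (map x xs))"
      using leaf_of(2)[OF *(1)] by blast
    obtain W where W: "W \<subseteq> order_cell ys" "open W" "W \<noteq> {}"
      "\<And>x. x \<in> W \<Longrightarrow> run (leaf_of xs) (plane_input N n x) = Some (staircase_value \<alpha> \<beta> \<gamma> (map x ys))"
      using leaf_of(2)[OF *(2)] unfolding *(3) by blast
    show False
      using leaves_separate_orders[OF leaf_of(1)[OF *(1)] perm[OF *(1)] perm[OF *(2)] *(4) \<gamma>
          V(2,3,1,4) W(2-4)] .
  qed
  moreover have "leaf_of ` Perms \<subseteq> straight T"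
    using leaf_of(1) by blast
  ultimately have "card Perms \<le> card (straight T)"
    using card_inj_on_le finite_straight by blast
  also have "\<dots> \<le> 3 ^ depth T"
    by (rule card_straight_le)
  finally show ?thesis
    by (simp add: Perms_def)
qed

section \<open>Growth of the factorial and the final bound\<close>

lemma ln_fact_ge: "real n * ln (real n) - real n \<le> ln (fact n)"
proof (cases "n = 0")
  case False
  \<comment> \<open>The left side is a single term of the exponential series at
    \<open>n\<close>.\<close>
  have "real n ^ n /\<^sub>R fact n \<le> exp (real n)"
    using sum_le_suminf[OF sums_summable[OF exp_converges], of "{n}" "real n"]
      sums_unique[OF exp_converges, of "real n"] by simp
  then have "ln (real n ^ n / fact n) \<le> ln (exp (real n))"
    using False by (intro ln_mono) (auto simp: divide_inverse mult.commute)
  then show ?thesis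
    using False by (simp add: ln_div ln_realpow)
qed simp

theorem proposition2:
  fixes N :: nat
  assumes "N \<ge> 2"
  shows "\<exists>c::real. c > 0 \<and>
    (\<forall>\<^sub>F n in sequentially. \<forall>T. computes_R2 N n T \<longrightarrow>
       c * (real n * ln (real n)) \<le> real (depth T))"
proof (intro exI conjI)
  \<comment> \<open>The factor \<open>ln 3\<close> comes from three-way branching; the factor 2
    absorbs the linear loss in \<open>ln_fact_ge\<close>.\<close>
  show "1 / (2 * ln 3) > (0::real)" by simp
  \<comment> \<open>From \<open>exp 2\<close> on, \<open>ln n\<close> is at least 2, so the loss
    \<open>n\<close> is at most half of \<open>n * ln n\<close>.\<close>
  have "\<forall>\<^sub>F n in sequentially. exp 2 \<le> real n"
    using filterlim_real_sequentially by (simp add: filterlim_at_top)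
  then show "\<forall>\<^sub>F n in sequentially. \<forall>T. computes_R2 N n T \<longrightarrow>
      1 / (2 * ln 3) * (real n * ln (real n)) \<le> real (depth T)"
  proof eventually_elim
    case (elim n)
    have n: "real n > 0"
      using elim exp_gt_zero[of "2::real"] by linarith
    have "2 \<le> ln (real n)"
      using elim n by (simp add: ln_ge_iff)
    then have "real n * 2 \<le> real n * ln (real n)"
      by (intro mult_left_mono) auto
    then have half: "real n * ln (real n) \<le> 2 * ln (fact n)"
      using ln_fact_ge[of n] by linarith
    show ?case
    proof (intro allI impI)
      fix T assume "computes_R2 N n T"
      then have "(fact n :: nat) \<le> 3 ^ depth T"
        using fact_le_three_power_depth assms n by simp
      then have "(fact n :: real) \<le> 3 ^ depth T"
        by (metis of_nat_fact of_nat_le_iff of_nat_numeral of_nat_power)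
      then have "ln (fact n :: real) \<le> real (depth T) * ln 3"
        using ln_mono[of "fact n" "3 ^ depth T :: real"] by (simp add: ln_realpow)
      with half show "1 / (2 * ln 3) * (real n * ln (real n)) \<le> real (depth T)"
        by (simp add: field_simps)
    qed
  qed
qed

end
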